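(* Let $\mathcal H=(V,E,w)$ be a weighted B-hypergraph of rank $\rho\ge 2$ on $V=\{1,\dots,N\}$, and let $f,\sigma:\mathbb R^d\to\mathbb R^d$ be sufficiently smooth and $M\in\mathbb R^{d\times d}$. Consider the system $$\dot x_i=f(x_i)+\sum_{k=1}^{\rho-1}\sum_{j_1,\dots,j_k=1}^N \mathsf A^{(k)}_{ij_1\cdots j_k}\,M\Big[\sigma\Big(\tfrac1k\sum_{r=1}^k x_{j_r}\Big)-\sigma(x_i)\Big],\qquad i=1,\dots,N,$$ with $x_i\in\mathbb R^d$. Let $\bar{\mathbf x}=(\bar x,\dots,\bar x)\in(\mathbb R^d)^N$ be a homogeneous equilibrium of this system. Then the linearized dynamics about $\bar{\mathbf x}$ is $$\dot{\delta\mathbf x}=\Big(I_N\otimes J_f-\sum_{k=1}^{\rho-1}L^{(k)}\otimes D_{\mathrm{eff}}\Big)\delta\mathbf x,$$ or equivalently $$\dot{\delta\mathbf x}=\big(I_N\otimes J_f-L_{\mathrm{tot}}\otimes D_{\mathrm{eff}}\big)\delta\mathbf x,$$ where $J_f=Df(\bar x)$, $D_{\mathrm{eff}}=M\,D\sigma(\bar x)$ and $L_{\mathrm{tot}}=\sum_{k=1}^{\rho-1}L^{(k)}$. In particular, the hypergraph influences the Jacobian at $\bar{\mathbf x}$ only through its zeroth tail moments $d^{(k)}_{\mathrm{in}}$ and first tail moments $A^{(k)}$: two B-hypergraphs on $V$ with the same $d^{(k)}_{\mathrm{in}}$ and the same $A^{(k)}$ for every $k$ give the same Jacobian (for the sa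me $f,\sigma,M$).
   Context: A weighted B-hypergraph $\mathcal H=(V,E,w)$ on $V=\{1,\dots,N\}$ consists of a finite set $E$ of B-arcs $e=(T\to i)$, where $T\subset V$ is a nonempty tail set and $i\in V\setminus T$ is the head, and weights $w:E\to\mathbb R_{>0}$. $E_k$ is the set of B-arcs with $|T|=k$. The rank is $\rho=\max_{e=(T\to i)\in E}(|T|+1)$. The adjacency tensor of order $k+1$ is $\mathsf A^{(k)}_{ij_1\cdots j_k}=w(e)/k!$ if $j_1,\dots,j_k$ are distinct and $e=(\{j_1,\dots,j_k\}\to i)\in E_k$, and $0$ otherwise. Zeroth tail moment (in-degree): $d^{(k)}_{\mathrm{in}}(i)=\sum_{e=(T\to i)\in E_k}w(e)$. First tail moment (exposure matrix): $A^{(k)}\in\mathbb R^{N\times N}$, $A^{(k)}_{ij}=\sum_{j_2,\dots,j_k}\mathsf A^{(k)}_{ijj_2\cdots j_k}=\sum_{e=(T\to i)\in E_k,\ j\in T}w(e)/k$. Set $L^{(k)}=\mathrm{diag}(d^{(k)}_{\mathrm{in}})-A^{(k)}$. A homogeneous equilibrium is an equilibrium whose node states all coincide; since the coupling vanishes on such states, this means $f(\bar x)=0$. The activation $\sigma$ acts componentwise and, like $M$, does not depend on the interaction order $k$. The linearized dynamics about $\bar{\mathbf x}$ is $\dot{\delta\mathbf x}=J\,\delta\mathbf x$ with $J$ the Jacobian of the right-hand side at $\bar{\mathbf x}$, where $(\mathbb R^d)^N$ is identified with $\mathbb R^N\otimes\mathbb R^d$. *)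

theory Defs
  imports "HOL-Analysis.Analysis"
begin

section \<open>Weighted B-hypergraphs\<close>

text \<open>The vertex set \<open>V\<close> is a finite type \<open>'n\<close>, so \<open>N = CARD('n)\<close> and the arc set is
  automatically finite. A B-arc \<open>T \<rightarrow> i\<close> is the pair \<open>(T, i)\<close>.\<close>

type_synonym 'n barc = "'n set \<times> 'n"

record 'n hypergraph =
  arcs :: "'n barc set"
  weight :: "'n barc \<Rightarrow> real"

definition b_hypergraph :: "'n::finite hypergraph \<Rightarrow> bool" where
  "b_hypergraph H \<longleftrightarrow>
     (\<forall>(T, i)\<in>arcs H. T \<noteq> {} \<and> i \<notin> T) \<and> (\<forall>e\<in>arcs H. weight H e > 0)"

definition arcs_of_order :: "'n::finite hypergraph \<Rightarrow> nat \<Rightarrow> 'n barc set" where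
  "arcs_of_order H k = {e \<in> arcs H. card (fst e) = k}"

text \<open>An arcless hypergraph gets rank 0, since \<open>Max {}\<close> is unspecified.\<close>

definition hypergraph_rank :: "'n::finite hypergraph \<Rightarrow> nat" where
  "hypergraph_rank H = (if arcs H = {} then 0 else Max ((\<lambda>e. card (fst e) + 1) ` arcs H))"

text \<open>A multi-index \<open>(j\<^sub>1, \<dots>, j\<^sub>k)\<close> is an element of \<open>{1..k} \<rightarrow>\<^sub>E UNIV\<close>.\<close>

definition adj_tensor :: "'n::finite hypergraph \<Rightarrow> nat \<Rightarrow> 'n \<Rightarrow> (nat \<Rightarrow> 'n) \<Rightarrow> real" where
  "adj_tensor H k i j =
     (if inj_on j {1..k} \<and> (j ` {1..k}, i) \<in> arcs_of_order H k
      then weight H (j ` {1..k}, i) / fact k else 0)"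

definition in_degree :: "'n::finite hypergraph \<Rightarrow> nat \<Rightarrow> 'n \<Rightarrow> real" where
  "in_degree H k i = (\<Sum>e \<in> {e \<in> arcs_of_order H k. snd e = i}. weight H e)"

text \<open>The sum runs over \<open>j\<^sub>2, \<dots>, j\<^sub>k\<close>, the first tensor slot being held at \<open>b\<close>.
  Only \<open>k \<ge> 1\<close> is meaningful.\<close>

definition exposure :: "'n::finite hypergraph \<Rightarrow> nat \<Rightarrow> real^'n^'n" where
  "exposure H k =
     (\<chi> i b. \<Sum>j \<in> {j \<in> {1..k} \<rightarrow>\<^sub>E UNIV. j 1 = b}. adj_tensor H k i j)"

definition laplacian :: "'n::finite hypergraph \<Rightarrow> nat \<Rightarrow> real^'n^'n" where
  "laplacian H k = (\<chi> i b. if i = b then in_degree H k i else 0) - exposure H k"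

definition total_laplacian :: "'n::finite hypergraph \<Rightarrow> real^'n^'n" where
  "total_laplacian H = (\<Sum>k = 1..hypergraph_rank H - 1. laplacian H k)"


section \<open>The dynamical system\<close>

definition vector_field ::
  "'n::finite hypergraph \<Rightarrow> (real^'d \<Rightarrow> real^'d) \<Rightarrow> (real^'d \<Rightarrow> real^'d) \<Rightarrow> real^'d^'d
    \<Rightarrow> real^'d^'n \<Rightarrow> real^'d^'n" where
  "vector_field H f \<sigma> M x =
     (\<chi> i. f (x $ i) +
        (\<Sum>k = 1..hypergraph_rank H - 1. \<Sum>j \<in> {1..k} \<rightarrow>\<^sub>E UNIV.
           adj_tensor H k i j *\<^sub>R
             (M *v (\<sigma> ((1 / real k) *\<^sub>R (\<Sum>r = 1..k. x $ j r)) - \<sigma> (x $ i)))))"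

definition homogeneous_state :: "real^'d \<Rightarrow> real^'d^'n" where
  "homogeneous_state a = (\<chi> i. a)"

definition is_equilibrium :: "(real^'d^'n \<Rightarrow> real^'d^'n) \<Rightarrow> real^'d^'n \<Rightarrow> bool" where
  "is_equilibrium F X \<longleftrightarrow> F X = 0"


section \<open>Linearization\<close>

text \<open>The identification of \<open>(\<real>\<^sup>d)\<^sup>N\<close> with \<open>\<real>\<^sup>N \<otimes> \<real>\<^sup>d\<close>, the latter having the
  standard basis indexed by pairs (node, component).\<close>

definition flatten :: "real^'d^'n \<Rightarrow> real^('n \<times> 'd)" where
  "flatten x = (\<chi> p. x $ fst p $ snd p)"

definition unflatten :: "real^('n \<times> 'd) \<Rightarrow> real^'d^'n" where
  "unflatten y = (\<chi> i a. y $ (i, a))"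

definition kronecker :: "real^'n^'n \<Rightarrow> real^'d^'d \<Rightarrow> real^('n \<times> 'd)^('n \<times> 'd)" where
  "kronecker A B = (\<chi> p q. A $ fst p $ fst q * B $ snd p $ snd q)"

definition state_jacobian ::
  "(real^'d^'n \<Rightarrow> real^'d^'n) \<Rightarrow> real^'d^'n \<Rightarrow> real^('n \<times> 'd)^('n \<times> 'd)" where
  "state_jacobian F X = jacobian (flatten \<circ> F \<circ> unflatten) (at (flatten X))"

text \<open>\<open>dx\<close> solves on the time set \<open>S\<close> the linearization of \<open>x' = F x\<close> about \<open>X\<close>.\<close>

definition solves_linearization ::
  "(real^'d^'n \<Rightarrow> real^'d^'n) \<Rightarrow> real^'d^'n \<Rightarrow> real set \<Rightarrow> (real \<Rightarrow> real^'d^'n) \<Rightarrow> bool" where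
  "solves_linearization F X S dx \<longleftrightarrow>
     (\<forall>t\<in>S. (dx has_vector_derivative frechet_derivative F (at X) (dx t)) (at t within S))"

text \<open>\<open>y\<close> solves \<open>y' = A y\<close> on the time set \<open>S\<close>.\<close>

definition solves_linear_ode ::
  "real^'m^'m \<Rightarrow> real set \<Rightarrow> (real \<Rightarrow> real^'m) \<Rightarrow> bool" where
  "solves_linear_ode A S y \<longleftrightarrow>
     (\<forall>t\<in>S. (y has_vector_derivative A *v y t) (at t within S))"

end

theory Submission
  imports Defs
begin

text \<open>At a homogeneous state every coupling term vanishes to zeroth order, so \<open>\<sigma>\<close> enters the
  derivative only through \<open>D\<sigma>(xbar)\<close> applied to the tail mean minus the head. The adjacency tensor
  is symmetric in its tail indices, so the tail mean may be replaced by the first tail entry; summing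
  out the other indices gives the exposure matrix, while summing out all of them gives the
  in-degree because every tail of size \<open>k\<close> has \<open>k!\<close> orderings. The order-\<open>k\<close> coupling thus
  linearizes to \<open>- L\<^sup>(\<^sup>k\<^sup>) \<otimes> D\<^sub>e\<^sub>f\<^sub>f\<close>.\<close>

section \<open>Moments of the adjacency tensor\<close>

text \<open>An injection of a \<open>k\<close>-element set into a \<open>k\<close>-element set is
  onto. The multi-indices enumerating \<open>T\<close> are therefore the injective ones into
  \<open>T\<close>, counted by the falling factorial \<open>k * (k - 1) * ... * 1\<close>.\<close>

lemma card_bijective_multi_indices:
  assumes "finite T" "card T = k"
  shows "card {j \<in> {1..k} \<rightarrow>\<^sub>E UNIV. inj_on j {1..k} \<and> j ` {1..k} = T} = fact k"
proof -
  have "{j \<in> {1..k} \<rightarrow>\<^sub>E UNIV. inj_on j {1..k} \<and> j ` {1..k} = T}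
      = {j \<in> {1..k} \<rightarrow>\<^sub>E T. inj_on j {1..k}}"
  proof (intro set_eqI iffI)
    fix j assume "j \<in> {j \<in> {1..k} \<rightarrow>\<^sub>E T. inj_on j {1..k}}"
    then have j: "j \<in> {1..k} \<rightarrow>\<^sub>E T" "inj_on j {1..k}" by auto
    then have "j ` {1..k} \<subseteq> T" by auto
    moreover have "card (j ` {1..k}) = card T"
      using j(2) assms by (simp add: card_image)
    ultimately have "j ` {1..k} = T"
      using assms(1) card_subset_eq by blast
    then show "j \<in> {j \<in> {1..k} \<rightarrow>\<^sub>E UNIV. inj_on j {1..k} \<and> j ` {1..k} = T}"
      using j by (auto simp: PiE_iff)
  qed (auto simp: PiE_iff)
  then show ?thesis
    using card_inj_on_subset_funcset[of "{1..k}" T "{1..k}"] assms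
    by (simp add: fact_prod_rev)
qed

text \<open>Grouping the contributing multi-indices by their image, each tail \<open>T\<close> is
  met once per ordering, and these \<open>fact k\<close> orderings cancel the normalization in
  \<open>adj_tensor\<close>.\<close>

lemma sum_adj_tensor:
  "(\<Sum>j \<in> {1..k} \<rightarrow>\<^sub>E UNIV. adj_tensor H k i j) = in_degree H k i"
proof -
  let ?J = "{1..k} \<rightarrow>\<^sub>E (UNIV :: 'a set)"
  let ?A = "{T. (T, i) \<in> arcs_of_order H k}"
  have "(\<Sum>j \<in> ?J. adj_tensor H k i j) =
      (\<Sum>j \<in> {j \<in> ?J. inj_on j {1..k} \<and> j ` {1..k} \<in> ?A}. weight H (j ` {1..k}, i) / fact k)"
    by (rule sum.mono_neutral_cong_right) (auto simp: adj_tensor_def finite_PiE)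
  also have "\<dots> = (\<Sum>T \<in> ?A. \<Sum>j \<in> {j \<in> {j \<in> ?J. inj_on j {1..k} \<and> j ` {1..k} \<in> ?A}. j ` {1..k} = T}.
      weight H (j ` {1..k}, i) / fact k)"
    by (rule sum.group[symmetric]) (auto simp: finite_PiE)
  also have "\<dots> = (\<Sum>T \<in> ?A. weight H (T, i))"
  proof (rule sum.cong[OF refl])
    fix T assume T: "T \<in> ?A"
    then have "{j \<in> {j \<in> ?J. inj_on j {1..k} \<and> j ` {1..k} \<in> ?A}. j ` {1..k} = T}
        = {j \<in> ?J. inj_on j {1..k} \<and> j ` {1..k} = T}"
      by auto
    moreover have "card T = k"
      using T by (simp add: arcs_of_order_def)
    ultimately show "(\<Sum>j \<in> {j \<in> {j \<in> ?J. inj_on j {1..k} \<and> j ` {1..k} \<in> ?A}. j ` {1..k} = T}.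
        weight H (j ` {1..k}, i) / fact k) = weight H (T, i)"
      using card_bijective_multi_indices[of T k] by simp
  qed
  also have "\<dots> = in_degree H k i"
    unfolding in_degree_def
    by (rule sum.reindex_bij_witness[where i = fst and j = "\<lambda>T. (T, i)"]) auto
  finally show ?thesis .
qed

text \<open>The entry sees \<open>j\<close> only through its image and its injectivity on
  \<open>{1..k}\<close>, both invariant under permuting the slots.\<close>

lemma adj_tensor_transpose:
  assumes "r \<in> {1..k}" "s \<in> {1..k}"
  shows "adj_tensor H k i (j \<circ> Transposition.transpose r s) = adj_tensor H k i j"
proof -
  have "(j \<circ> Transposition.transpose r s) ` {1..k} = j ` {1..k}"
    using assms by (metis image_comp transpose_image_eq)
  moreover have "inj_on (j \<circ> Transposition.transpose r s) {1..k} \<longleftrightarrow> inj_on j {1..k}"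
    using assms by (metis comp_inj_on_iff inj_on_transpose transpose_image_eq)
  ultimately show ?thesis
    by (simp add: adj_tensor_def)
qed

text \<open>\<open>exposure\<close> singles out slot 1. Swapping slots \<open>r\<close> and 1 is an
  involution of the multi-indices that preserves the tensor, so every slot has the same first
  moment.\<close>

lemma sum_adj_tensor_slot:
  fixes g :: "'n::finite \<Rightarrow> 'v::real_vector"
  assumes "r \<in> {1..k}"
  shows "(\<Sum>j \<in> {1..k} \<rightarrow>\<^sub>E UNIV. adj_tensor H k i j *\<^sub>R g (j r))
      = (\<Sum>b \<in> UNIV. exposure H k $ i $ b *\<^sub>R g b)"
proof -
  let ?J = "{1..k} \<rightarrow>\<^sub>E (UNIV :: 'n set)"
  have one: "1 \<in> {1..k}"
    using assms by auto
  \<comment> \<open>Multi-indices must stay \<open>undefined\<close> off \<open>{1..k}\<close>; the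
    swap fixes all such points because both swapped slots lie inside.\<close>
  have closed: "j \<circ> Transposition.transpose r 1 \<in> ?J" if "j \<in> ?J" for j
  proof (rule PiE_I)
    fix x assume "x \<notin> {1..k}"
    moreover from this have "Transposition.transpose r 1 x = x"
      using assms one by (intro transpose_apply_other) auto
    ultimately show "(j \<circ> Transposition.transpose r 1) x = undefined"
      using PiE_arb[OF that] by (simp only: comp_apply)
  qed simp
  have "(\<Sum>j \<in> ?J. adj_tensor H k i j *\<^sub>R g (j r)) = (\<Sum>j \<in> ?J. adj_tensor H k i j *\<^sub>R g (j 1))"
    by (rule sum.reindex_bij_witness
        [where i = "\<lambda>j. j \<circ> Transposition.transpose r 1" and j = "\<lambda>j. j \<circ> Transposition.transpose r 1"])
      (simp_all only: closed adj_tensor_transpose[OF assms one] comp_assoc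
        transpose_comp_involutory comp_id comp_apply transpose_apply_second)
  also have "\<dots> = (\<Sum>b \<in> UNIV. \<Sum>j \<in> {j \<in> ?J. j 1 = b}. adj_tensor H k i j *\<^sub>R g (j 1))"
    by (rule sum.group[symmetric]) (auto simp: finite_PiE)
  also have "\<dots> = (\<Sum>b \<in> UNIV. exposure H k $ i $ b *\<^sub>R g b)"
    by (rule sum.cong) (auto simp: exposure_def scaleR_sum_left intro!: sum.cong)
  finally show ?thesis .
qed

text \<open>Each of the \<open>k\<close> slots in the mean contributes the same exposure sum, so the
  factor \<open>1 / real k\<close> averages equal terms. The head term collects the in-degree, the
  diagonal part of the Laplacian.\<close>

lemma sum_adj_tensor_mean_diff:
  fixes x :: "'v::real_vector^'n::finite"
  assumes "k \<ge> 1"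
  shows "(\<Sum>j \<in> {1..k} \<rightarrow>\<^sub>E UNIV.
        adj_tensor H k i j *\<^sub>R ((1 / real k) *\<^sub>R (\<Sum>r = 1..k. x $ j r) - x $ i))
      = - (\<Sum>b \<in> UNIV. laplacian H k $ i $ b *\<^sub>R x $ b)"
proof -
  let ?J = "{1..k} \<rightarrow>\<^sub>E (UNIV :: 'n set)"
  let ?E = "\<Sum>b \<in> UNIV. exposure H k $ i $ b *\<^sub>R x $ b"
  have "(\<Sum>j \<in> ?J. adj_tensor H k i j *\<^sub>R ((1 / real k) *\<^sub>R (\<Sum>r = 1..k. x $ j r)))
      = (1 / real k) *\<^sub>R (\<Sum>j \<in> ?J. \<Sum>r = 1..k. adj_tensor H k i j *\<^sub>R x $ j r)"
    by (simp add: scaleR_sum_right mult.commute)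
  also have "\<dots> = (1 / real k) *\<^sub>R (\<Sum>r = 1..k. \<Sum>j \<in> ?J. adj_tensor H k i j *\<^sub>R x $ j r)"
    by (subst sum.swap) simp
  also have "\<dots> = (1 / real k) *\<^sub>R (\<Sum>r = 1..k. ?E)"
    by (intro arg_cong[where f = "scaleR _"] sum.cong refl)
      (rule sum_adj_tensor_slot[where g = "\<lambda>b. x $ b"])
  also have "\<dots> = ?E"
    using assms by (simp add: sum_constant_scaleR)
  finally have mean:
    "(\<Sum>j \<in> ?J. adj_tensor H k i j *\<^sub>R ((1 / real k) *\<^sub>R (\<Sum>r = 1..k. x $ j r))) = ?E" .
  have "(\<Sum>b \<in> UNIV. laplacian H k $ i $ b *\<^sub>R x $ b)
      = (\<Sum>b \<in> UNIV. if i = b then in_degree H k i *\<^sub>R x $ b else 0) - ?E"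
    unfolding sum_subtractf[symmetric]
    by (rule sum.cong) (auto simp: laplacian_def scaleR_diff_left)
  also have "\<dots> = in_degree H k i *\<^sub>R x $ i - ?E"
    by simp
  finally show ?thesis
    by (simp only: scaleR_diff_right sum_subtractf mean scaleR_sum_left[symmetric] sum_adj_tensor
        minus_diff_eq)
qed

text \<open>The rank counts the head as well, so an arc with a tail of size \<open>k\<close> forces
  rank at least \<open>k + 1\<close>.\<close>

lemma arcs_of_order_eq_empty:
  assumes "k \<ge> hypergraph_rank H" "k \<ge> 1"
  shows "arcs_of_order H k = {}"
proof (rule ccontr)
  assume "arcs_of_order H k \<noteq> {}"
  then obtain e where e: "e \<in> arcs H" "card (fst e) = k"
    by (auto simp: arcs_of_order_def)
  then have "k + 1 \<le> Max ((\<lambda>e. card (fst e) + 1) ` arcs H)"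
    by (intro Max_ge) (auto intro!: image_eqI[of _ _ e])
  with e assms show False
    by (auto simp: hypergraph_rank_def split: if_splits)
qed

lemma laplacian_eq_0:
  assumes "k \<ge> hypergraph_rank H" "k \<ge> 1"
  shows "laplacian H k = 0"
  using arcs_of_order_eq_empty[OF assms]
  by (simp add: laplacian_def in_degree_def exposure_def adj_tensor_def vec_eq_iff)

text \<open>The moments fix each Laplacian, but the two sums may a priori have different ranges
  because the ranks may differ. Both are extended to a common bound \<open>K\<close> by zero
  terms.\<close>

lemma total_laplacian_cong:
  assumes "\<And>k i. k \<ge> 1 \<Longrightarrow> in_degree H' k i = in_degree H k i"
    and "\<And>k. k \<ge> 1 \<Longrightarrow> exposure H' k = exposure H k"
  shows "total_laplacian H' = total_laplacian H"
proof -
  define K where "K = max (hypergraph_rank H) (hypergraph_rank H')"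
  have "total_laplacian G = (\<Sum>k = 1..K. laplacian G k)" if "hypergraph_rank G \<le> K" for G :: "'a hypergraph"
    \<comment> \<open>An order in \<open>1..K\<close> missing from the original range is at least
      the rank; this includes rank 0, where truncated subtraction leaves that range empty.\<close>
    unfolding total_laplacian_def
    using that by (intro sum.mono_neutral_left) (auto intro!: laplacian_eq_0)
  moreover have "laplacian H' k = laplacian H k" if "k \<ge> 1" for k
    using assms that by (simp add: laplacian_def vec_eq_iff)
  moreover have "hypergraph_rank H \<le> K" "hypergraph_rank H' \<le> K"
    by (simp_all add: K_def)
  ultimately show ?thesis
    by simp
qed

section \<open>Coordinates\<close>

lemma bounded_linear_flatten: "bounded_linear flatten"
  by (intro linear_conv_bounded_linear[THEN iffD1] linearI)
    (simp_all add: flatten_def vec_eq_iff)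

lemma bounded_linear_unflatten: "bounded_linear unflatten"
  by (intro linear_conv_bounded_linear[THEN iffD1] linearI)
    (simp_all add: unflatten_def vec_eq_iff)

lemma unflatten_flatten [simp]: "unflatten (flatten x) = x"
  by (simp add: flatten_def unflatten_def vec_eq_iff)

lemma flatten_unflatten [simp]: "flatten (unflatten y) = y"
  by (simp add: flatten_def unflatten_def vec_eq_iff)

text \<open>Splitting the sum over pairs shows \<open>A\<close> mixing the nodes while
  \<open>B\<close> acts within each node, so Kronecker products can be handled without
  coordinates.\<close>

lemma kronecker_mult_flatten:
  "kronecker A B *v flatten x = flatten (\<chi> i. \<Sum>b\<in>UNIV. A $ i $ b *\<^sub>R (B *v x $ b))"
proof -
  have "(\<Sum>q\<in>UNIV. A $ i $ fst q * B $ a $ snd q * x $ fst q $ snd q)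
      = (\<Sum>b\<in>UNIV. A $ i $ b * (\<Sum>c\<in>UNIV. B $ a $ c * x $ b $ c))" for i a
    unfolding UNIV_Times_UNIV[symmetric]
    by (subst sum.cartesian_product') (simp add: sum_distrib_left mult.assoc)
  then show ?thesis
    by (simp add: vec_eq_iff kronecker_def flatten_def matrix_vector_mult_def)
qed

lemma kronecker_mat_1_mult_flatten:
  "kronecker (mat 1) B *v flatten x = flatten (\<chi> i. B *v x $ i)"
proof -
  have "(\<Sum>b\<in>UNIV. (mat 1 :: real^'a^'a) $ i $ b *\<^sub>R (B *v x $ b)) = B *v x $ i" for i
    by (simp add: mat_def if_distrib[of "\<lambda>c. c *\<^sub>R _"] cong: if_cong)
  then show ?thesis
    by (simp add: kronecker_mult_flatten)
qed

lemma kronecker_sum_left: "kronecker (\<Sum>k\<in>S. A k) B = (\<Sum>k\<in>S. kronecker (A k) B)"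
  by (simp add: vec_eq_iff kronecker_def sum_distrib_right)

text \<open>Differentiability can be tested against basis vectors, and a basis vector
  \<open>axis i u\<close> sees only component \<open>i\<close>.\<close>

lemma has_derivative_vec_lambda:
  fixes f :: "'a::real_normed_vector \<Rightarrow> 'n::finite \<Rightarrow> 'b::euclidean_space"
  assumes "\<And>i. ((\<lambda>x. f x i) has_derivative (\<lambda>h. f' h i)) (at a within S)"
  shows "((\<lambda>x. \<chi> i. f x i) has_derivative (\<lambda>h. \<chi> i. f' h i)) (at a within S)"
proof (subst has_derivative_componentwise_within, rule ballI)
  fix b :: "'b^'n" assume "b \<in> Basis"
  then obtain i u where "b = axis i u"
    by (auto simp: Basis_vec_def)
  then show "((\<lambda>x. (\<chi> i. f x i) \<bullet> b) has_derivative (\<lambda>h. (\<chi> i. f' h i) \<bullet> b)) (at a within S)"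
    using has_derivative_inner_left[OF assms[of i], of u] by (simp add: inner_axis)
qed

text \<open>By the chain rule, conjugating \<open>F\<close> with the coordinate isomorphism
  conjugates its derivative; uniqueness of the derivative then identifies the matrix.\<close>

lemma state_jacobian_eqI:
  assumes "(F has_derivative D) (at X)" "\<And>x. flatten (D x) = A *v flatten x"
  shows "state_jacobian F X = A"
proof -
  have "(F has_derivative D) (at (unflatten (flatten X)))"
    using assms(1) by simp
  then have "((\<lambda>y. flatten (F (unflatten y))) has_derivative (\<lambda>y. flatten (D (unflatten y))))
      (at (flatten X))"
    by (intro bounded_linear.has_derivative[OF bounded_linear_flatten]
        has_derivative_compose[OF bounded_linear_imp_has_derivative[OF bounded_linear_unflatten]])
  then have "((flatten \<circ> F \<circ> unflatten) has_derivative (\<lambda>y. A *v y)) (at (flatten X))"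
    by (simp add: assms(2) comp_def)
  then show ?thesis
    by (simp add: state_jacobian_def jacobian_def flip: frechet_derivative_at)
qed

lemma solves_linearization_iff:
  assumes "(F has_derivative D) (at X)" "\<And>x. flatten (D x) = A *v flatten x"
  shows "solves_linearization F X S dx \<longleftrightarrow> solves_linear_ode A S (\<lambda>t. flatten (dx t))"
proof -
  \<comment> \<open>A bounded linear map carries derivatives of curves along: \<open>flatten\<close>
    gives one direction, its inverse \<open>unflatten\<close> the other.\<close>
  have "(dx has_vector_derivative v) (at t within S)
      \<longleftrightarrow> ((\<lambda>t. flatten (dx t)) has_vector_derivative flatten v) (at t within S)" for t v
    using bounded_linear.has_vector_derivative[OF bounded_linear_flatten, of dx v "at t within S"]
      bounded_linear.has_vector_derivative[OF bounded_linear_unflatten,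
        of "\<lambda>t. flatten (dx t)" "flatten v" "at t within S"]
    by auto
  then show ?thesis
    by (simp add: solves_linearization_def solves_linear_ode_def assms(2)
        flip: frechet_derivative_at[OF assms(1)])
qed

section \<open>The linearization\<close>

text \<open>Term-by-term differentiation gives the raw form \<open>?D\<close>; the moment identities
  then turn it into the Laplacian form.\<close>

lemma vector_field_has_derivative:
  fixes H :: "'n::finite hypergraph" and f \<sigma> :: "real^'d::finite \<Rightarrow> real^'d"
  assumes f: "(f has_derivative (\<lambda>h. P *v h)) (at a)"
    and \<sigma>: "(\<sigma> has_derivative (\<lambda>h. Q *v h)) (at a)"
  shows "(vector_field H f \<sigma> M has_derivative
      (\<lambda>h. \<chi> i. P *v h $ i - (\<Sum>b\<in>UNIV. total_laplacian H $ i $ b *\<^sub>R ((M ** Q) *v h $ b))))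
      (at (homogeneous_state a))"
proof -
  let ?X = "homogeneous_state a :: real^'d^'n"
  let ?J = "\<lambda>k. {1..k} \<rightarrow>\<^sub>E (UNIV :: 'n set)"
  let ?D = "\<lambda>h i. P *v h $ i + (\<Sum>k = 1..hypergraph_rank H - 1. \<Sum>j \<in> ?J k.
      adj_tensor H k i j *\<^sub>R
        (M *v (Q *v ((1 / real k) *\<^sub>R (\<Sum>r = 1..k. h $ j r)) - Q *v h $ i)))"
  have nth: "((\<lambda>x. x $ i) has_derivative (\<lambda>h. h $ i)) (at ?X)" for i :: 'n
    by (rule bounded_linear_imp_has_derivative) (rule bounded_linear_vec_nth)
  have mean: "((\<lambda>x. \<sigma> ((1 / real k) *\<^sub>R (\<Sum>r = 1..k. x $ j r))) has_derivative
      (\<lambda>h. Q *v ((1 / real k) *\<^sub>R (\<Sum>r = 1..k. h $ j r)))) (at ?X)"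
    if "k \<ge> 1" for k and j :: "nat \<Rightarrow> 'n"
  proof (rule has_derivative_compose[where g = \<sigma> and g' = "\<lambda>h. Q *v h"])
    show "((\<lambda>x. (1 / real k) *\<^sub>R (\<Sum>r = 1..k. x $ j r)) has_derivative
        (\<lambda>h. (1 / real k) *\<^sub>R (\<Sum>r = 1..k. h $ j r))) (at ?X)"
      by (intro has_derivative_scaleR_right has_derivative_sum nth)
    \<comment> \<open>The tail mean of a homogeneous state is \<open>a\<close> again, so \<sigma> is
      differentiated at \<open>a\<close> only. Here \<open>k \<ge> 1\<close> matters: for
      \<open>k = 0\<close> the expression would be 0.\<close>
    have "(1 / real k) *\<^sub>R (\<Sum>r = 1..k. ?X $ j r) = a"
      using that by (simp add: homogeneous_state_def sum_constant_scaleR del: sum_constant)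
    then show "(\<sigma> has_derivative (\<lambda>h. Q *v h)) (at ((1 / real k) *\<^sub>R (\<Sum>r = 1..k. ?X $ j r)))"
      using \<sigma> by (simp only:)
  qed
  have node: "((\<lambda>x. g (x $ i)) has_derivative (\<lambda>h. R *v h $ i)) (at ?X)"
    if "(g has_derivative (\<lambda>h. R *v h)) (at a)" for g :: "real^'d \<Rightarrow> real^'d" and R and i :: 'n
    using that by (intro has_derivative_compose[OF nth, where g = g and g' = "\<lambda>h. R *v h"])
      (simp add: homogeneous_state_def)
  have "(vector_field H f \<sigma> M has_derivative (\<lambda>h. \<chi> i. ?D h i)) (at ?X)"
    unfolding vector_field_def[abs_def]
    by (intro has_derivative_vec_lambda has_derivative_add has_derivative_sum
        has_derivative_scaleR_right bounded_linear.has_derivative[OF matrix_vector_mul_bounded_linear]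
        has_derivative_diff mean node f \<sigma>) auto
  moreover have "?D h i
      = P *v h $ i - (\<Sum>b\<in>UNIV. total_laplacian H $ i $ b *\<^sub>R ((M ** Q) *v h $ b))"
    for h :: "real^'d^'n" and i
  proof -
    let ?B = "M ** Q"
    have lin: "linear ((*v) ?B)"
      by (rule matrix_vector_mul_linear)
    have "(\<Sum>j \<in> ?J k. adj_tensor H k i j *\<^sub>R
          (M *v (Q *v ((1 / real k) *\<^sub>R (\<Sum>r = 1..k. h $ j r)) - Q *v h $ i)))
        = - (\<Sum>b\<in>UNIV. laplacian H k $ i $ b *\<^sub>R (?B *v h $ b))" if "k \<ge> 1" for k
    proof -
      \<comment> \<open>Pulling the common linear factor \<open>?B\<close> out of the sum leaves the
        weighted mean difference of the node perturbations themselves.\<close>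
      have "(\<Sum>j \<in> ?J k. adj_tensor H k i j *\<^sub>R
            (M *v (Q *v ((1 / real k) *\<^sub>R (\<Sum>r = 1..k. h $ j r)) - Q *v h $ i)))
          = ?B *v (\<Sum>j \<in> ?J k. adj_tensor H k i j *\<^sub>R
              ((1 / real k) *\<^sub>R (\<Sum>r = 1..k. h $ j r) - h $ i))"
        by (simp only: linear_sum[OF lin] linear_scale[OF lin])
          (simp add: matrix_vector_mul_assoc matrix_vector_mult_diff_distrib)
      also have "\<dots> = - (\<Sum>b\<in>UNIV. laplacian H k $ i $ b *\<^sub>R (?B *v h $ b))"
        by (simp only: sum_adj_tensor_mean_diff[OF that] linear_neg[OF lin] linear_sum[OF lin]
            linear_scale[OF lin])
      finally show ?thesis .
    qed
    then have "?D h i = P *v h $ i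
        - (\<Sum>k = 1..hypergraph_rank H - 1. \<Sum>b\<in>UNIV. laplacian H k $ i $ b *\<^sub>R (?B *v h $ b))"
      by (simp add: sum_negf)
    also have "(\<Sum>k = 1..hypergraph_rank H - 1. \<Sum>b\<in>UNIV. laplacian H k $ i $ b *\<^sub>R (?B *v h $ b))
        = (\<Sum>b\<in>UNIV. total_laplacian H $ i $ b *\<^sub>R (?B *v h $ b))"
      by (subst sum.swap) (simp add: total_laplacian_def scaleR_sum_left)
    finally show ?thesis .
  qed
  ultimately show ?thesis
    by (simp only:)
qed

theorem theorem4p5:
  fixes H :: "'n::finite hypergraph"
    and f \<sigma> :: "real^'d::finite \<Rightarrow> real^'d"
    and M :: "real^'d^'d"
    and xbar :: "real^'d"
  assumes "b_hypergraph H"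
    and "hypergraph_rank H \<ge> 2"
    and "f differentiable (at xbar)"
    and "\<sigma> differentiable (at xbar)"
    and "is_equilibrium (vector_field H f \<sigma> M) (homogeneous_state xbar)"
  shows
    "let X = homogeneous_state xbar;
         F = vector_field H f \<sigma> M;
         Jf = jacobian f (at xbar);
         Deff = M ** jacobian \<sigma> (at xbar);
         J1 = kronecker (mat 1) Jf - (\<Sum>k = 1..hypergraph_rank H - 1. kronecker (laplacian H k) Deff);
         J2 = kronecker (mat 1) Jf - kronecker (total_laplacian H) Deff
     in F differentiable (at X)
      \<and> state_jacobian F X = J1
      \<and> state_jacobian F X = J2
      \<and> (\<forall>S dx. solves_linearization F X S dx \<longleftrightarrow> solves_linear_ode J1 S (\<lambda>t. flatten (dx t)))
      \<and> (\<forall>S dx. solves_linearization F X S dx \<longleftrightarrow> solves_linear_ode J2 S (\<lambda>t. flatten (dx t)))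
      \<and> (\<forall>H' :: 'n hypergraph.
            b_hypergraph H' \<longrightarrow>
            (\<forall>k\<ge>1. \<forall>i. in_degree H' k i = in_degree H k i) \<longrightarrow>
            (\<forall>k\<ge>1. exposure H' k = exposure H k) \<longrightarrow>
            vector_field H' f \<sigma> M differentiable (at X) \<and>
            state_jacobian (vector_field H' f \<sigma> M) X = state_jacobian F X)"
proof -
  define X :: "real^'d^'n" where "X = homogeneous_state xbar"
  define P where "P = jacobian f (at xbar)"
  define Q where "Q = jacobian \<sigma> (at xbar)"
  define D where "D G h = (\<chi> i. P *v h $ i
      - (\<Sum>b\<in>UNIV. total_laplacian G $ i $ b *\<^sub>R ((M ** Q) *v h $ b)))"
    for G :: "'n hypergraph" and h
  define J where "J G = kronecker (mat 1) P - kronecker (total_laplacian G) (M ** Q)"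
    for G :: "'n hypergraph"
  \<comment> \<open>Stated for every \<open>G\<close>, since the comparison claim also needs the
    derivative for \<open>H'\<close>.\<close>
  have deriv: "(vector_field G f \<sigma> M has_derivative D G) (at X)" for G
    using vector_field_has_derivative[of f P xbar \<sigma> Q G M] assms(3,4)
    by (simp add: X_def P_def Q_def D_def[abs_def] jacobian_works)
  have flat: "flatten (D G h) = J G *v flatten h" for G h
  proof -
    have "flatten (D G h) = flatten (\<chi> i. P *v h $ i)
        - flatten (\<chi> i. \<Sum>b\<in>UNIV. total_laplacian G $ i $ b *\<^sub>R ((M ** Q) *v h $ b))"
      by (simp add: D_def flatten_def vec_eq_iff)
    then show ?thesis
      by (simp only: J_def matrix_vector_mult_diff_rdistrib kronecker_mat_1_mult_flatten
          kronecker_mult_flatten[of "total_laplacian G"])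
  qed
  have diff: "vector_field G f \<sigma> M differentiable (at X)" for G
    using deriv by (rule differentiableI)
  have jac: "state_jacobian (vector_field G f \<sigma> M) X = J G" for G
    by (rule state_jacobian_eqI[OF deriv flat])
  have ode: "solves_linearization (vector_field H f \<sigma> M) X S dx
      \<longleftrightarrow> solves_linear_ode (J H) S (\<lambda>t. flatten (dx t))" for S dx
    by (rule solves_linearization_iff[OF deriv flat])
  \<comment> \<open>Additivity of the Kronecker product in its left factor makes the two forms of
    the Jacobian one matrix.\<close>
  have J1: "kronecker (mat 1) P - (\<Sum>k = 1..hypergraph_rank H - 1. kronecker (laplacian H k) (M ** Q))
      = J H"
    by (simp add: J_def total_laplacian_def kronecker_sum_left)
  have J': "J H' = J H"
    if "\<forall>k\<ge>1. \<forall>i. in_degree H' k i = in_degree H k i" "\<forall>k\<ge>1. exposure H' k = exposure H k"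
    for H'
    unfolding J_def using total_laplacian_cong[of H' H] that by simp
  show ?thesis
    unfolding Let_def X_def[symmetric] P_def[symmetric] Q_def[symmetric] J1 J_def[symmetric]
    unfolding jac by (intro conjI allI impI diff refl ode J') simp_all
qed

end
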